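(* Let $t_1,t_2$ and $h_i,l_i,\tilde h_i,\tilde l_i,\alpha_i,\tilde\alpha_i$ ($i=1,2$), $\beta,\tilde\beta,\mu_0,\mu,\chi,\nu$ be complex parameters satisfying \begin{gather*} \chi = \big( \tilde{h}_1 + \tilde{h}_2 - \tilde{l}_1 - \tilde{l}_2 + \tilde{\alpha }_1 - \tilde{\alpha }_2 - \tilde{\beta } \big)/2 , \qquad \nu = \mu _0 + \alpha _1 - \tilde{\alpha }_2 , \qquad \mu = \mu _0 + \chi + 1, \\ \beta = - \tilde{\beta } - \chi , \qquad \alpha _2 = \alpha _1 + \tilde{\alpha }_1 - \tilde{\alpha }_2 - \chi , \\ l_i =\tilde{h}_i + \mu _0 , \qquad h_i = \tilde{l}_i +\mu _0 + \chi ,\qquad i=1,2. \end{gather*} Then the function $\Phi (x,s ) = x^{- \alpha _1} s^{1+\chi - \tilde{\alpha }_1} P^{(1)}_{\mu ,\mu _0} (x,s)$ satisfies $$A^{\langle 4 \rangle} ( x; h_1, h_2, l_1, l_2, \alpha _1, \alpha _2, \beta ) \Phi (x,s ) = q^{\nu } A^{\langle 4 \rangle} \big( s; \tilde{h}_1, \tilde{h}_2, \tilde{l}_1, \tilde{l}_2, \tilde{\alpha }_1, \tilde{\alpha }_2, \tilde{\beta } \big) \Phi (x,s ) .$$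
   Context: $q$ is a complex number with $0<|q|<1$. Complex powers are taken with a fixed branch of $\log q$, so that $q^a=\exp(a\log q)$ and power functions obey $(q^{\pm1}x)^a=q^{\pm a}x^a$. Identities are understood at points where all expressions are defined. Notation: $(a;q)_\infty=\prod_{j=0}^\infty(1-q^ja)$ and $$P^{(1)}_{\mu ,\mu _0 } (x,s)= \frac{(q^{\mu }s/x;q)_{\infty }}{(q^{\mu _0 }s/x;q)_{\infty }}.$$ $T_x^{\pm1}$ is the $q$-shift operator in $x$, $T_x^{\pm1}g(x)=g(q^{\pm1}x)$, acting on the variable $x$ only (similarly $T_s^{\pm 1}$). With fixed complex parameters $t_1,t_2$ (the same for both operators), the operator $A^{\langle 4\rangle}$ is \begin{gather*} A^{\langle 4 \rangle} ( x; h_1, h_2, l_1, l_2, \alpha _1, \alpha _2, \beta ) = x^{-1} (x-q^{h_1 + 1/2} t_1) (x-q^{h_2 +1/2} t_2) T_{x}^{-1} \\ {}+ q^{\alpha _1 +\alpha _2} x^{-1} (x - q^{l_1 -1/2} t_1) (x - q^{l_2 -1/2} t_2) T_{x}\\ {}-\big\{ (q^{\alpha _1} +q^{\alpha _2} ) x + q^{(h_1 +h_2 + l_1 +l_2 +\alpha _1 +\alpha _2 )/2}( q^{\beta/2} + q^{-\beta/2} ) t_1 t_2 x^{-1} \big\}. \end{gather*} $A^{\langle 4 \rangle}(s;\dots)$ is the same operator with $x$ replaced by $s$ and $T_x$ by $T_s$. *)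

theory Defs
  imports "HOL-Analysis.Analysis"
begin

text \<open>
  A fixed logarithm \<open>lq\<close> of \<open>q\<close> (so that \<open>exp lq = q\<close>) is passed around explicitly.
\<close>

definition qpow :: "complex \<Rightarrow> complex \<Rightarrow> complex" where
  "qpow lq a = exp (a * lq)"

text \<open>
  A branch of the logarithm on a \<open>q\<close>-invariant set \<open>D\<close>, compatible with the chosen logarithm of
  \<open>q\<close>. It is what makes the power functions \<open>x\<^sup>a = exp (a log x)\<close> satisfy
  \<open>(q x)\<^sup>a = q\<^sup>a x\<^sup>a\<close> and \<open>(q\<^sup>-\<^sup>1 x)\<^sup>a = q\<^sup>-\<^sup>a x\<^sup>a\<close> on \<open>D\<close>; the principal branch does not do so
  in general. Continuity plays no role and is not required.
\<close>

definition q_log_branch ::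
  "complex \<Rightarrow> complex \<Rightarrow> complex set \<Rightarrow> (complex \<Rightarrow> complex) \<Rightarrow> bool" where
  "q_log_branch q lq D lg \<longleftrightarrow>
     (\<forall>x\<in>D. exp (lg x) = x
        \<and> q * x \<in> D \<and> lg (q * x) = lq + lg x
        \<and> inverse q * x \<in> D \<and> lg (inverse q * x) = - lq + lg x)"

definition power_fn :: "(complex \<Rightarrow> complex) \<Rightarrow> complex \<Rightarrow> complex \<Rightarrow> complex" where
  "power_fn lg a x = exp (a * lg x)"

lemma power_fn_qshift:
  assumes "q_log_branch q lq D lg" "x \<in> D"
  shows "power_fn lg a (q * x) = qpow lq a * power_fn lg a x"
    and "power_fn lg a (inverse q * x) = qpow lq (- a) * power_fn lg a x"
proof -
  have "lg (q * x) = lq + lg x" "lg (inverse q * x) = - lq + lg x"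
    using assms unfolding q_log_branch_def by blast+
  then show "power_fn lg a (q * x) = qpow lq a * power_fn lg a x"
    and "power_fn lg a (inverse q * x) = qpow lq (- a) * power_fn lg a x"
    unfolding power_fn_def qpow_def by (simp_all add: ring_distribs flip: exp_add)
qed

definition qpoch_inf :: "complex \<Rightarrow> complex \<Rightarrow> complex" where
  "qpoch_inf a q = (\<Prod>j. 1 - q ^ j * a)"

definition P1 ::
  "complex \<Rightarrow> complex \<Rightarrow> complex \<Rightarrow> complex \<Rightarrow> complex \<Rightarrow> complex \<Rightarrow> complex" where
  "P1 q lq \<mu> \<mu>0 x s =
     qpoch_inf (qpow lq \<mu> * s / x) q / qpoch_inf (qpow lq \<mu>0 * s / x) q"

definition P1_defined_at :: "complex \<Rightarrow> complex \<Rightarrow> complex \<Rightarrow> complex \<Rightarrow> complex \<Rightarrow> bool" where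
  "P1_defined_at q lq \<mu>0 x s \<longleftrightarrow> x \<noteq> 0 \<and> qpoch_inf (qpow lq \<mu>0 * s / x) q \<noteq> 0"

text \<open>\<open>qshift q\<close> and \<open>qshift (inverse q)\<close> are the operators \<open>T\<close> and \<open>T\<^sup>-\<^sup>1\<close>.\<close>

definition qshift :: "complex \<Rightarrow> (complex \<Rightarrow> complex) \<Rightarrow> complex \<Rightarrow> complex" where
  "qshift c g x = g (c * x)"

definition A4 ::
  "complex \<Rightarrow> complex \<Rightarrow> complex \<Rightarrow> complex \<Rightarrow>
   complex \<Rightarrow> complex \<Rightarrow> complex \<Rightarrow> complex \<Rightarrow> complex \<Rightarrow> complex \<Rightarrow> complex \<Rightarrow>
   (complex \<Rightarrow> complex) \<Rightarrow> complex \<Rightarrow> complex" where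
  "A4 q lq t1 t2 h1 h2 l1 l2 \<alpha>1 \<alpha>2 \<beta> g x =
     inverse x * (x - qpow lq (h1 + 1/2) * t1) * (x - qpow lq (h2 + 1/2) * t2)
       * qshift (inverse q) g x
   + qpow lq (\<alpha>1 + \<alpha>2) * inverse x
       * (x - qpow lq (l1 - 1/2) * t1) * (x - qpow lq (l2 - 1/2) * t2) * qshift q g x
   - ((qpow lq \<alpha>1 + qpow lq \<alpha>2) * x
      + qpow lq ((h1 + h2 + l1 + l2 + \<alpha>1 + \<alpha>2) / 2)
        * (qpow lq (\<beta> / 2) + qpow lq (- (\<beta> / 2))) * t1 * t2 * inverse x) * g x"

end

theory Submission
  imports Defs
begin

text \<open>
  The kernel depends on \<open>x\<close> and \<open>s\<close> only through \<open>z = s / x\<close>, so a shift of \<open>x\<close> up is a shift of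
  \<open>s\<close> down: both operators see only the three values \<open>F\<^sub>+\<close>, \<open>F\<close>, \<open>F\<^sub>-\<close> of the kernel at \<open>q z\<close>,
  \<open>z\<close>, \<open>z / q\<close>. These are linked by the first-order relations
  \<open>(1 - q\<^sup>\<mu> z) F\<^sub>+ = (1 - q\<^sup>\<mu>\<^sup>0 z) F\<close> and \<open>(1 - q\<^sup>\<mu>\<^sup>0 z / q) F\<^sub>- = (1 - q\<^sup>\<mu> z / q) F\<close>
  (\<open>qpoch_inf_ratio_shift\<close>).

  In the difference of the two sides of the claim, divided by the power prefactors, the coefficient
  of \<open>F\<^sub>+\<close> compares a quadratic in \<open>x\<close> to a quadratic in \<open>s\<close>, and the zeros of the first are
  \<open>q\<^sup>\<mu>\<close> times the zeros of the second. This is what the relations between the \<open>h\<^sub>i\<close> and the \<open>l\<^sub>i'\<close>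
  are for: it makes the coefficient divisible by \<open>1 - q\<^sup>\<mu> z\<close> (\<open>scaled_quadratics_diff\<close>). In the
  same way the relations between the \<open>l\<^sub>i\<close> and the \<open>h\<^sub>i'\<close> make the coefficient of \<open>F\<^sub>-\<close> divisible by
  \<open>1 - q\<^sup>\<mu>\<^sup>0 z / q\<close>. Hence everything reduces to a multiple of \<open>F\<close>, and the vanishing of its
  coefficient is a comparison of the monomials \<open>x\<close>, \<open>s\<close>, \<open>t\<^sub>1 t\<^sub>2 / x\<close>, \<open>t\<^sub>1 t\<^sub>2 / s\<close>, each
  occurring twice. The relations for \<open>\<alpha>\<^sub>2\<close>, \<open>\<beta>\<close>, \<open>\<nu>\<close> and \<open>\<chi>\<close> make the exponents of \<open>q\<close> agree.

  The first-order relations stay in the form cleared of denominators: at a point with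
  \<open>q\<^sup>\<mu> z = 1\<close> the kernel vanishes while \<open>F\<^sub>+\<close> may not, so \<open>F\<^sub>+\<close> is not a multiple of \<open>F\<close>.
\<close>

lemma qpow_mult: "qpow lq a * qpow lq b = qpow lq (a + b)"
  by (simp add: qpow_def ring_distribs exp_add)

lemma convergent_prod_qpoch_inf:
  fixes a q :: complex
  assumes "norm q < 1"
  shows "convergent_prod (\<lambda>j. 1 - q ^ j * a)"
proof -
  have "summable (\<lambda>j. norm (q ^ j * a))"
    using assms by (simp add: norm_mult norm_power summable_mult2)
  then have "abs_convergent_prod (\<lambda>j. 1 + - (q ^ j * a))"
    by (intro summable_imp_abs_convergent_prod) simp
  then show ?thesis
    by (simp add: abs_convergent_prod_imp_convergent_prod)
qed

text \<open>
  Passing to the limit in the partial products covers the case of a vanishing factor as well.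
\<close>

lemma qpoch_inf_rec:
  assumes "norm q < 1"
  shows "qpoch_inf a q = (1 - a) * qpoch_inf (q * a) q"
proof -
  have lim: "(\<lambda>n. \<Prod>j\<le>n. 1 - q ^ j * b) \<longlonglongrightarrow> qpoch_inf b q" for b
    unfolding qpoch_inf_def
    by (intro convergent_prod_LIMSEQ convergent_prod_qpoch_inf assms)
  have split: "(\<Prod>j\<le>Suc n. 1 - q ^ j * a) = (1 - a) * (\<Prod>j\<le>n. 1 - q ^ j * (q * a))" for n
    by (subst prod.atMost_Suc_shift) (simp add: mult_ac)
  have "(\<lambda>n. \<Prod>j\<le>Suc n. 1 - q ^ j * a) \<longlonglongrightarrow> (1 - a) * qpoch_inf (q * a) q"
    unfolding split by (intro tendsto_mult_left lim)
  moreover have "(\<lambda>n. \<Prod>j\<le>Suc n. 1 - q ^ j * a) \<longlonglongrightarrow> qpoch_inf a q"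
    using lim[of a] by (rule LIMSEQ_Suc)
  ultimately show ?thesis
    using LIMSEQ_unique by blast
qed

lemma qpoch_inf_ratio_shift:
  assumes "norm q < 1" "qpoch_inf a q \<noteq> 0"
  shows "(1 - b) * (qpoch_inf (q * b) q / qpoch_inf (q * a) q)
       = (1 - a) * (qpoch_inf b q / qpoch_inf a q)"
proof -
  have "1 - a \<noteq> 0"
    using assms(2) qpoch_inf_rec[OF assms(1), of a] by auto
  then show ?thesis
    unfolding qpoch_inf_rec[OF assms(1), of a] qpoch_inf_rec[OF assms(1), of b] by simp
qed

text \<open>
  The first term is homogeneous of degree one in \<open>x\<close>, \<open>m d\<^sub>1\<close>, \<open>m d\<^sub>2\<close>, so at \<open>x = m s\<close> it
  equals the second. Hence the factor \<open>1 - m s / x\<close>.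
\<close>

lemma scaled_quadratics_diff:
  fixes x s :: "'a :: field"
  assumes "x \<noteq> 0" "s \<noteq> 0"
  shows "inverse x * (x - m * d1) * (x - m * d2) - m * (inverse s * (s - d1) * (s - d2))
       = (1 - m * s / x) * (x - m * d1 * d2 / s)"
  using assms by (simp add: field_simps)

theorem theorem1p1:
  fixes q lq t1 t2 :: complex
    and h1 h2 l1 l2 \<alpha>1 \<alpha>2 \<beta> :: complex
    and h1' h2' l1' l2' \<alpha>1' \<alpha>2' \<beta>' :: complex
    and \<mu>0 \<mu> chi \<nu> :: complex
    and Dx Ds :: "complex set" and lgx lgs :: "complex \<Rightarrow> complex"
    and \<Phi> :: "complex \<Rightarrow> complex \<Rightarrow> complex"
    and x s :: complex
  assumes q: "0 < norm q" "norm q < 1"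
    and log_q: "exp lq = q"
    and branch_x: "q_log_branch q lq Dx lgx"
    and branch_s: "q_log_branch q lq Ds lgs"
    and chi_eq: "chi = (h1' + h2' - l1' - l2' + \<alpha>1' - \<alpha>2' - \<beta>') / 2"
    and nu: "\<nu> = \<mu>0 + \<alpha>1 - \<alpha>2'"
    and mu: "\<mu> = \<mu>0 + chi + 1"
    and beta: "\<beta> = - \<beta>' - chi"
    and alpha2: "\<alpha>2 = \<alpha>1 + \<alpha>1' - \<alpha>2' - chi"
    and l: "l1 = h1' + \<mu>0" "l2 = h2' + \<mu>0"
    and h: "h1 = l1' + \<mu>0 + chi" "h2 = l2' + \<mu>0 + chi"
    and Phi: "\<Phi> = (\<lambda>x s. power_fn lgx (- \<alpha>1) x * power_fn lgs (1 + chi - \<alpha>1') s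
                        * P1 q lq \<mu> \<mu>0 x s)"
    and point: "x \<in> Dx" "s \<in> Ds"
    and defined: "P1_defined_at q lq \<mu>0 x s"
      "P1_defined_at q lq \<mu>0 (q * x) s" "P1_defined_at q lq \<mu>0 (inverse q * x) s"
      "P1_defined_at q lq \<mu>0 x (q * s)" "P1_defined_at q lq \<mu>0 x (inverse q * s)"
  shows "A4 q lq t1 t2 h1 h2 l1 l2 \<alpha>1 \<alpha>2 \<beta> (\<lambda>x. \<Phi> x s) x
       = qpow lq \<nu> * A4 q lq t1 t2 h1' h2' l1' l2' \<alpha>1' \<alpha>2' \<beta>' (\<lambda>s. \<Phi> x s) s"
proof -
  let ?E = "qpow lq"
  have q0: "q \<noteq> 0"
    using q by auto
  have E1: "?E 1 = q" "?E (-1) = inverse q"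
    using log_q by (simp_all add: qpow_def exp_minus)
  have x0: "x \<noteq> 0" and s0: "s \<noteq> 0"
    using point branch_x branch_s exp_not_eq_zero unfolding q_log_branch_def by metis+

  define c where "c = 1 + chi - \<alpha>1'"
  define u where "u = power_fn lgx (- \<alpha>1) x * power_fn lgs c s"
  define F where "F = P1 q lq \<mu> \<mu>0 x s"
  define Fp where "Fp = P1 q lq \<mu> \<mu>0 (inverse q * x) s"
  define Fm where "Fm = P1 q lq \<mu> \<mu>0 (q * x) s"

  have Fp_s: "P1 q lq \<mu> \<mu>0 x (q * s) = Fp" and Fm_s: "P1 q lq \<mu> \<mu>0 x (inverse q * s) = Fm"
    using q0 x0 by (simp_all add: Fp_def Fm_def P1_def field_simps)

  have Fp_rel: "(1 - ?E \<mu> * s / x) * Fp = (1 - ?E \<mu>0 * s / x) * F"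
    using qpoch_inf_ratio_shift[OF q(2), of "?E \<mu>0 * s / x" "?E \<mu> * s / x"] defined(1) q0
    by (simp add: Fp_def F_def P1_def P1_defined_at_def field_simps)
  have shift_down: "?E (a - 1) * s / x = ?E a * s / (q * x)" for a
    using qpow_mult[of lq a "-1", symmetric] by (simp add: E1 divide_inverse mult_ac)
  have Fm_rel: "(1 - ?E (\<mu>0 - 1) * s / x) * Fm = (1 - ?E (\<mu> - 1) * s / x) * F"
    using qpoch_inf_ratio_shift[OF q(2), of "?E \<mu>0 * s / (q * x)" "?E \<mu> * s / (q * x)"]
      defined(2) q0 unfolding shift_down
    by (simp add: Fm_def F_def P1_def P1_defined_at_def)

  have Phi_vals:
    "\<Phi> x s = u * F"
    "\<Phi> (inverse q * x) s = u * (?E \<alpha>1 * Fp)"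
    "\<Phi> (q * x) s = u * (?E (- \<alpha>1) * Fm)"
    "\<Phi> x (q * s) = u * (?E c * Fp)"
    "\<Phi> x (inverse q * s) = u * (?E (- c) * Fm)"
    unfolding Phi c_def[symmetric] power_fn_qshift[OF branch_x point(1)]
      power_fn_qshift[OF branch_s point(2)] Fp_s Fm_s
    by (simp_all add: u_def F_def Fp_def Fm_def mult_ac)

  have sum_h': "h1' + h2' = l1' + l2' - \<alpha>1' + \<alpha>2' + \<beta>' + 2 * chi"
    using chi_eq by (simp add: field_simps)
  have h1': "h1' = l1' + l2' - \<alpha>1' + \<alpha>2' + \<beta>' + 2 * chi - h2'"
    using sum_h' by (simp add: algebra_simps)

  \<comment> \<open>The zeros in the \<open>x\<close>-operator are those in the \<open>s\<close>-operator scaled by \<open>q\<^sup>\<mu>\<close> and \<open>q\<^sup>\<mu>\<^sup>0\<^sup>-\<^sup>1\<close>.\<close>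
  have zeros:
    "?E (h1 + 1/2) * t1 = ?E \<mu> * (?E (l1' - 1/2) * t1)"
    "?E (h2 + 1/2) * t2 = ?E \<mu> * (?E (l2' - 1/2) * t2)"
    "?E (l1 - 1/2) * t1 = ?E (\<mu>0 - 1) * (?E (h1' + 1/2) * t1)"
    "?E (l2 - 1/2) * t2 = ?E (\<mu>0 - 1) * (?E (h2' + 1/2) * t2)"
    by (unfold mult.assoc[symmetric] qpow_mult, simp_all add: h l mu algebra_simps)
  have coeffs:
    "?E (\<alpha>1 + \<alpha>2) * ?E (- \<alpha>1) = ?E \<alpha>2"
    "?E \<nu> * ?E (- c) = ?E \<alpha>2 * ?E (\<mu>0 - 1)"
    "?E \<nu> * (?E (\<alpha>1' + \<alpha>2') * ?E c) = ?E \<alpha>1 * ?E \<mu>"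
    by (simp_all add: qpow_mult nu c_def alpha2 mu algebra_simps)

  define D where "D = (?E (l1' - 1/2) * t1) * (?E (l2' - 1/2) * t2)"
  define C where "C = (?E (h1' + 1/2) * t1) * (?E (h2' + 1/2) * t2)"
  define V where "V = (?E \<alpha>1 + ?E \<alpha>2) * x
      + ?E ((h1 + h2 + l1 + l2 + \<alpha>1 + \<alpha>2) / 2) * (?E (\<beta> / 2) + ?E (- (\<beta> / 2)))
        * t1 * t2 * inverse x"
  define V' where "V' = (?E \<alpha>1' + ?E \<alpha>2') * s
      + ?E ((h1' + h2' + l1' + l2' + \<alpha>1' + \<alpha>2') / 2) * (?E (\<beta>' / 2) + ?E (- (\<beta>' / 2)))
        * t1 * t2 * inverse s"

  have D_eq: "D = ?E (l1' + l2' - 1) * t1 * t2"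
  proof -
    have "?E (l1' + l2' - 1) = ?E (l1' - 1/2) * ?E (l2' - 1/2)"
      by (simp add: qpow_mult)
    then show ?thesis
      by (simp add: D_def mult_ac)
  qed
  have C_eq: "C = ?E (h1' + h2' + 1) * t1 * t2"
  proof -
    have "?E (h1' + h2' + 1) = ?E (h1' + 1/2) * ?E (h2' + 1/2)"
      by (simp add: qpow_mult add_ac)
    then show ?thesis
      by (simp add: C_def mult_ac)
  qed

  \<comment> \<open>Substituting \<open>h1' + h2'\<close> cancels the halves in the exponents. The summand with \<open>q\<^sup>\<beta>\<^sup>/\<^sup>2\<close>
    then cancels against the multiple of \<open>F\<close> that comes from \<open>F\<^sub>+\<close>, the one with \<open>q\<^sup>-\<^sup>\<beta>\<^sup>/\<^sup>2\<close>
    against that from \<open>F\<^sub>-\<close>; on the \<open>s\<close>-side the two signs swap roles.\<close>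
  have V_half:
    "?E ((h1 + h2 + l1 + l2 + \<alpha>1 + \<alpha>2) / 2) * ?E (\<beta> / 2)
      = ?E \<alpha>1 * (?E \<mu>0 * (?E \<mu> * ?E (l1' + l2' - 1)))"
    "?E ((h1 + h2 + l1 + l2 + \<alpha>1 + \<alpha>2) / 2) * ?E (- (\<beta> / 2))
      = ?E \<alpha>2 * (?E (\<mu> - 1) * (?E (\<mu>0 - 1) * ?E (h1' + h2' + 1)))"
    unfolding qpow_mult
    by (rule arg_cong[where f = ?E], simp add: h l mu beta alpha2 h1' field_simps)+
  have V'_half:
    "?E \<nu> * (?E ((h1' + h2' + l1' + l2' + \<alpha>1' + \<alpha>2') / 2) * ?E (- (\<beta>' / 2)))
      = ?E \<alpha>1 * (?E \<mu> * ?E (l1' + l2' - 1))"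
    "?E \<nu> * (?E ((h1' + h2' + l1' + l2' + \<alpha>1' + \<alpha>2') / 2) * ?E (\<beta>' / 2))
      = ?E \<alpha>2 * (?E (\<mu>0 - 1) * ?E (h1' + h2' + 1))"
    unfolding qpow_mult
    by (rule arg_cong[where f = ?E], simp add: nu mu alpha2 h1' field_simps)+
  have V'_lin: "?E \<nu> * ?E \<alpha>2' = ?E \<alpha>1 * ?E \<mu>0" "?E \<nu> * ?E \<alpha>1' = ?E \<alpha>2 * ?E (\<mu> - 1)"
    by (simp_all add: qpow_mult nu mu alpha2 algebra_simps)

  have V_eq: "V = ?E \<alpha>1 * (x + ?E \<mu>0 * ?E \<mu> * D / x)
                + ?E \<alpha>2 * (x + ?E (\<mu> - 1) * ?E (\<mu>0 - 1) * C / x)"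
    unfolding V_def D_eq C_eq distrib_left V_half by (simp add: algebra_simps divide_inverse)
  have "?E \<nu> * V' = (?E \<nu> * ?E \<alpha>2') * s + (?E \<nu> * ?E \<alpha>1') * s
      + (?E \<nu> * (?E ((h1' + h2' + l1' + l2' + \<alpha>1' + \<alpha>2') / 2) * ?E (- (\<beta>' / 2))))
        * t1 * t2 * inverse s
      + (?E \<nu> * (?E ((h1' + h2' + l1' + l2' + \<alpha>1' + \<alpha>2') / 2) * ?E (\<beta>' / 2)))
        * t1 * t2 * inverse s"
    unfolding V'_def by (simp add: algebra_simps)
  then have V'_eq: "?E \<nu> * V' = ?E \<alpha>1 * (?E \<mu>0 * s + ?E \<mu> * D / s)
                + ?E \<alpha>2 * (?E (\<mu> - 1) * s + ?E (\<mu>0 - 1) * C / s)"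
    unfolding D_eq C_eq V'_half V'_lin by (simp add: algebra_simps divide_inverse)
  have V_diff: "V - ?E \<nu> * V'
      = ?E \<alpha>1 * (1 - ?E \<mu>0 * s / x) * (x - ?E \<mu> * D / s)
      + ?E \<alpha>2 * (1 - ?E (\<mu> - 1) * s / x) * (x - ?E (\<mu>0 - 1) * C / s)"
    unfolding V_eq V'_eq using x0 s0 by (simp add: field_simps)

  define Xp where "Xp = inverse x * (x - ?E (h1 + 1/2) * t1) * (x - ?E (h2 + 1/2) * t2)"
  define Xm where "Xm = inverse x * (x - ?E (l1 - 1/2) * t1) * (x - ?E (l2 - 1/2) * t2)"
  define Sp where "Sp = inverse s * (s - ?E (l1' - 1/2) * t1) * (s - ?E (l2' - 1/2) * t2)"
  define Sm where "Sm = inverse s * (s - ?E (h1' + 1/2) * t1) * (s - ?E (h2' + 1/2) * t2)"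

  have plus: "(Xp - ?E \<mu> * Sp) * Fp
      = (x - ?E \<mu> * D / s) * ((1 - ?E \<mu>0 * s / x) * F)"
    unfolding Xp_def Sp_def zeros scaled_quadratics_diff[OF x0 s0] Fp_rel[symmetric]
    by (simp add: D_def mult_ac)
  have minus: "(Xm - ?E (\<mu>0 - 1) * Sm) * Fm
      = (x - ?E (\<mu>0 - 1) * C / s) * ((1 - ?E (\<mu> - 1) * s / x) * F)"
    unfolding Xm_def Sm_def zeros scaled_quadratics_diff[OF x0 s0] Fm_rel[symmetric]
    by (simp add: C_def mult_ac)

  have A_x: "A4 q lq t1 t2 h1 h2 l1 l2 \<alpha>1 \<alpha>2 \<beta> (\<lambda>x. \<Phi> x s) x
      = u * (?E \<alpha>1 * Xp * Fp + (?E (\<alpha>1 + \<alpha>2) * ?E (- \<alpha>1)) * Xm * Fm - V * F)"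
    unfolding A4_def qshift_def Phi_vals Xp_def Xm_def V_def by (simp only: algebra_simps)
  have A_s: "?E \<nu> * A4 q lq t1 t2 h1' h2' l1' l2' \<alpha>1' \<alpha>2' \<beta>' (\<lambda>s. \<Phi> x s) s
      = u * ((?E \<nu> * ?E (- c)) * Sm * Fm + (?E \<nu> * (?E (\<alpha>1' + \<alpha>2') * ?E c)) * Sp * Fp
          - ?E \<nu> * V' * F)"
    unfolding A4_def qshift_def Phi_vals Sp_def Sm_def V'_def by (simp only: algebra_simps)

  have "A4 q lq t1 t2 h1 h2 l1 l2 \<alpha>1 \<alpha>2 \<beta> (\<lambda>x. \<Phi> x s) x
      - ?E \<nu> * A4 q lq t1 t2 h1' h2' l1' l2' \<alpha>1' \<alpha>2' \<beta>' (\<lambda>s. \<Phi> x s) s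
      = u * (?E \<alpha>1 * ((Xp - ?E \<mu> * Sp) * Fp) + ?E \<alpha>2 * ((Xm - ?E (\<mu>0 - 1) * Sm) * Fm)
          - (V - ?E \<nu> * V') * F)"
    unfolding A_x A_s coeffs by (simp only: algebra_simps)
  also have "\<dots> = 0"
    unfolding plus minus V_diff by (simp add: algebra_simps)
  finally show ?thesis
    by simp
qed

end
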